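(* Suppose that the primal feasible set $X=\{x\in C: b-A(x)\in K\}$ is nonempty and bounded. Whenever the dual problem (D) is feasible, and in particular when $c\in(\operatorname{lineal} C)^{\perp}$ or when $C$ is pointed, strong duality holds between (P) and (D). If one also assumes that at least one of $K$ or $C$ is not a linear subspace and not equal to $\{0\}$, then the dual feasible set $Y=\{y\in K^*: A^*(y)-c\in C^*\}$ is unbounded.
   Context: $E,E'$ are finite-dimensional real inner-product spaces; $C\subseteq E$ and $K\subseteq E'$ are nonempty closed convex cones (so they contain the origin), with $C\neq\{0\}$ and with $C\neq E$ or $K\neq E'$; $A:E\to E'$ is linear with adjoint $A^*:E'\to E$; $b\in E'$, $c\in E$. For a cone $D$, $D^*=\{y:\langle x,y\rangle\ge 0\ \forall x\in D\}$ is its dual cone and $\operatorname{lineal}D=D\cap(-D)$ is its lineality space; $D$ is pointed if $\operatorname{lineal}D=\{0\}$. The primal conic program is (P): $z_P^*=\sup\{\langle c,x\rangle : b-A(x)\in K,\ x\in C\}$ and its dual is (D): $z_D^*=\inf\{\langle b,y\rangle : A^*(y)-c\in C^*,\ y\in K^*\}$. Strong duality means that $z_P^*=z_D^*$ (values $\pm\infty$ allowed) and, if these values are finite, at least one of the two problems has an optimal solution. *)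

theory Defs
  imports "HOL-Analysis.Analysis"
begin

definition dual_cone :: "'a::real_inner set \<Rightarrow> 'a set" where
  "dual_cone D = {y. \<forall>x\<in>D. 0 \<le> x \<bullet> y}"

definition lineal :: "'a::real_vector set \<Rightarrow> 'a set" where
  "lineal D = D \<inter> uminus ` D"

definition pointed_cone :: "'a::real_vector set \<Rightarrow> bool" where
  "pointed_cone D \<longleftrightarrow> lineal D = {0}"

definition primal_feasible ::
  "('a::euclidean_space \<Rightarrow> 'b::euclidean_space) \<Rightarrow> 'b \<Rightarrow> 'a set \<Rightarrow> 'b set \<Rightarrow> 'a set" where
  "primal_feasible A b C K = {x \<in> C. b - A x \<in> K}"

definition dual_feasible ::
  "('a::euclidean_space \<Rightarrow> 'b::euclidean_space) \<Rightarrow> 'a \<Rightarrow> 'a set \<Rightarrow> 'b set \<Rightarrow> 'b set" where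
  "dual_feasible A c C K = {y \<in> dual_cone K. adjoint A y - c \<in> dual_cone C}"

text \<open>Optimal values are extended reals: the supremum over an empty feasible set is
  \<open>-\<infinity>\<close> and the infimum over an empty feasible set is \<open>\<infinity>\<close>.\<close>

definition primal_value ::
  "('a::euclidean_space \<Rightarrow> 'b::euclidean_space) \<Rightarrow> 'b \<Rightarrow> 'a \<Rightarrow> 'a set \<Rightarrow> 'b set \<Rightarrow> ereal" where
  "primal_value A b c C K = (SUP x\<in>primal_feasible A b C K. ereal (c \<bullet> x))"

definition dual_value ::
  "('a::euclidean_space \<Rightarrow> 'b::euclidean_space) \<Rightarrow> 'b \<Rightarrow> 'a \<Rightarrow> 'a set \<Rightarrow> 'b set \<Rightarrow> ereal" where
  "dual_value A b c C K = (INF y\<in>dual_feasible A c C K. ereal (b \<bullet> y))"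

definition primal_optimal ::
  "('a::euclidean_space \<Rightarrow> 'b::euclidean_space) \<Rightarrow> 'b \<Rightarrow> 'a \<Rightarrow> 'a set \<Rightarrow> 'b set \<Rightarrow> 'a \<Rightarrow> bool" where
  "primal_optimal A b c C K x \<longleftrightarrow>
     x \<in> primal_feasible A b C K \<and> ereal (c \<bullet> x) = primal_value A b c C K"

definition dual_optimal ::
  "('a::euclidean_space \<Rightarrow> 'b::euclidean_space) \<Rightarrow> 'b \<Rightarrow> 'a \<Rightarrow> 'a set \<Rightarrow> 'b set \<Rightarrow> 'b \<Rightarrow> bool" where
  "dual_optimal A b c C K y \<longleftrightarrow>
     y \<in> dual_feasible A c C K \<and> ereal (b \<bullet> y) = dual_value A b c C K"

definition strong_duality ::
  "('a::euclidean_space \<Rightarrow> 'b::euclidean_space) \<Rightarrow> 'b \<Rightarrow> 'a \<Rightarrow> 'a set \<Rightarrow> 'b set \<Rightarrow> bool" where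
  "strong_duality A b c C K \<longleftrightarrow>
     primal_value A b c C K = dual_value A b c C K \<and>
     (\<bar>primal_value A b c C K\<bar> \<noteq> \<infinity> \<longrightarrow>
        (\<exists>x. primal_optimal A b c C K x) \<or> (\<exists>y. dual_optimal A b c C K y))"

end

theory Submission
  imports Defs
begin

text \<open>
  Boundedness of the nonempty primal feasible set says exactly that its recession cone
  \<open>{x \<in> C. - A x \<in> K}\<close> is trivial. This is a closedness condition in disguise: a linear image
  of a closed cone is closed as soon as the kernel of the map meets the cone only in the origin
  (\<open>closed_linear_image_cone\<close>), and for both of the maps
  \<open>(x, k) \<mapsto> A x + k\<close> on \<open>C \<times> K\<close> and
  \<open>(x, k, s) \<mapsto> (A x + k, c \<bullet> x - s)\<close> on \<open>C \<times> K \<times> [0, \<infinity>)\<close>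
  this condition reduces to triviality of the recession cone.

  The second image is the set of pairs (right-hand side, attainable objective level). If no
  primal feasible point reaches the level \<open>z\<close>, then \<open>(b, z)\<close> lies outside this closed convex
  cone, and a separating functional is, up to scaling, a dual feasible point of value below \<open>z\<close>
  (\<open>dual_feasible_point_below\<close>); the separator cannot be degenerate because the primal is
  feasible. Taking \<open>z\<close> slightly above the primal maximum, which is attained by compactness,
  gives at once dual feasibility and the absence of a duality gap.

  The dual cone of the first image \<open>A C + K\<close> is the recession cone of the dual feasible set.
  If the latter were trivial, separation would give that \<open>A C + K\<close> is the whole space. Then the
  negative of an element of \<open>K\<close> or of \<open>A C\<close> is again of the form \<open>A x + k\<close>, and triviality of
  the primal recession cone turns this into closure of \<open>K\<close> and of \<open>C\<close> under negation, so that
  both are subspaces.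
\<close>

section \<open>Closed convex cones\<close>

lemma cone_add_closed:
  assumes "convex D" "cone D" "x \<in> D" "y \<in> D"
  shows "x + y \<in> D"
  using assms convex_cone by blast

lemma zero_in_nonempty_cone: "cone D \<Longrightarrow> D \<noteq> {} \<Longrightarrow> 0 \<in> D"
  using cone_contains_0 by blast

lemma convex_cone_subspaceI:
  assumes "D \<noteq> {}" "convex D" "cone D" and neg: "\<And>x. x \<in> D \<Longrightarrow> - x \<in> D"
  shows "subspace D"
  unfolding subspace_def
proof (intro conjI ballI allI)
  show "0 \<in> D" using zero_in_nonempty_cone assms by blast
  show "x + y \<in> D" if "x \<in> D" "y \<in> D" for x y
    using cone_add_closed assms that by blast
  show "r *\<^sub>R x \<in> D" if "x \<in> D" for r x
  proof (cases "0 \<le> r")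
    case True
    then show ?thesis using assms(3) that by (simp add: cone_def)
  next
    case False
    then have "(- r) *\<^sub>R (- x) \<in> D"
      using assms(3) neg[OF that] unfolding cone_def by (meson linear neg_0_le_iff_le)
    then show ?thesis by simp
  qed
qed

lemma cone_linear_image: "cone D \<Longrightarrow> linear f \<Longrightarrow> cone (f ` D)"
  by (auto simp: cone_def linear_cmul[symmetric])

lemma cone_separation:
  fixes D :: "'a::euclidean_space set"
  assumes "closed D" "convex D" "cone D" "D \<noteq> {}" "v \<notin> D"
  obtains y where "y \<in> dual_cone D" "v \<bullet> y < 0"
proof -
  obtain a \<beta> where a: "a \<bullet> v < \<beta>" and \<beta>: "\<And>x. x \<in> D \<Longrightarrow> \<beta> < a \<bullet> x"
    using separating_hyperplane_closed_point[of D v] assms by blast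
  have "\<beta> < 0" using \<beta>[OF zero_in_nonempty_cone] assms by simp
  have "0 \<le> x \<bullet> a" if "x \<in> D" for x
  proof (rule ccontr)
    assume "\<not> 0 \<le> x \<bullet> a"
    then have neg: "a \<bullet> x < 0" by (simp add: inner_commute)
    \<comment> \<open>Scaling \<open>x\<close> by this factor puts it exactly on the separating hyperplane.\<close>
    have "(\<beta> / (a \<bullet> x)) *\<^sub>R x \<in> D"
      using assms(3) that neg \<open>\<beta> < 0\<close> by (simp add: cone_def divide_nonpos_nonpos)
    from \<beta>[OF this] neg show False by simp
  qed
  then have "a \<in> dual_cone D" by (simp add: dual_cone_def)
  moreover have "v \<bullet> a < 0" using a \<open>\<beta> < 0\<close> by (simp add: inner_commute)
  ultimately show ?thesis using that by blast
qed

text \<open>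
  By compactness of the unit sphere, a linear map that vanishes nowhere on the cone except at
  the origin is bounded below there by a positive multiple of the norm. Points of the image near
  a given point therefore come from a bounded, hence compact, part of the cone.
\<close>
lemma closed_linear_image_cone:
  fixes T :: "'a::euclidean_space \<Rightarrow> 'b::euclidean_space"
  assumes "linear T" "closed D" "cone D" and ker: "\<And>u. u \<in> D \<Longrightarrow> T u = 0 \<Longrightarrow> u = 0"
  shows "closed (T ` D)"
proof -
  have contT: "continuous_on S T" for S
    using assms(1) linear_continuous_on linear_conv_bounded_linear by blast
  obtain m where m: "m > 0" "\<And>u. u \<in> D \<Longrightarrow> m * norm u \<le> norm (T u)"
  proof (cases "D \<inter> sphere 0 1 = {}")
    case True
    have "u = 0" if "u \<in> D" for u
    proof (rule ccontr)
      assume "u \<noteq> 0"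
      then have "inverse (norm u) *\<^sub>R u \<in> D \<inter> sphere 0 1"
        using assms(3) that by (simp add: cone_def)
      with True show False by blast
    qed
    then show ?thesis using that[of 1] by fastforce
  next
    case False
    have "compact (D \<inter> sphere 0 1)"
      using assms(2) by (simp add: closed_Int_compact)
    then obtain w where w: "w \<in> D \<inter> sphere 0 1"
      "\<And>u. u \<in> D \<inter> sphere 0 1 \<Longrightarrow> norm (T w) \<le> norm (T u)"
      using continuous_attains_inf[of "D \<inter> sphere 0 1" "\<lambda>u. norm (T u)"] False
        continuous_on_norm[OF contT] by blast
    have "norm (T w) > 0" using w(1) ker[of w] by auto
    moreover have "norm (T w) * norm u \<le> norm (T u)" if "u \<in> D" for u
    proof (cases "u = 0")
      case True
      then show ?thesis by simp
    next
      case False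
      then have "inverse (norm u) *\<^sub>R u \<in> D \<inter> sphere 0 1"
        using assms(3) that by (simp add: cone_def)
      then have "norm (T w) \<le> norm (T (inverse (norm u) *\<^sub>R u))" by (rule w(2))
      also have "\<dots> = norm (T u) / norm u"
        by (simp add: linear_cmul[OF assms(1)] divide_inverse mult.commute)
      finally show ?thesis using False by (simp add: pos_le_divide_eq)
    qed
    ultimately show ?thesis using that by blast
  qed
  have "v \<in> T ` D" if v: "v \<in> closure (T ` D)" for v
  proof -
    define r where "r = (norm v + 1) / m"
    have "compact (D \<inter> cball 0 r)"
      using assms(2) by (simp add: closed_Int_compact)
    then have cl: "closed (T ` (D \<inter> cball 0 r))"
      using compact_continuous_image[OF contT] compact_imp_closed by blast
    have "\<exists>p \<in> T ` (D \<inter> cball 0 r). dist p v < e" if "e > 0" for e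
    proof -
      have "min e 1 > 0" using that by simp
      then obtain u where u: "u \<in> D" "dist (T u) v < min e 1"
        using v unfolding closure_approachable by blast
      have "norm (T u) \<le> norm v + 1"
        using norm_triangle_sub[of "T u" v] u(2) by (simp add: dist_norm)
      then have "norm u \<le> r"
        using m(2)[OF u(1)] m(1) by (simp add: r_def pos_le_divide_eq mult.commute)
      then have "T u \<in> T ` (D \<inter> cball 0 r)" using u(1) by simp
      then show ?thesis using u(2) by auto
    qed
    then have "v \<in> closure (T ` (D \<inter> cball 0 r))" by (simp add: closure_approachable)
    then show ?thesis using cl by auto
  qed
  then show ?thesis by (metis closure_subset_eq subsetI)
qed

lemma bounded_no_recession_direction:
  fixes d :: "'a::real_normed_vector"
  assumes "bounded S" and ray: "\<And>t. t \<ge> 0 \<Longrightarrow> x + t *\<^sub>R d \<in> S"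
  shows "d = 0"
proof (rule ccontr)
  assume "d \<noteq> 0"
  obtain B where B: "\<And>z. z \<in> S \<Longrightarrow> norm z \<le> B" using assms(1) by (auto simp: bounded_iff)
  define t where "t = (B + norm x + 1) / norm d"
  have "0 \<le> B" using order_trans[OF norm_ge_zero B[OF ray[of 0]]] by simp
  then have t: "t \<ge> 0" "norm (t *\<^sub>R d) = B + norm x + 1"
    using \<open>d \<noteq> 0\<close> by (simp_all add: t_def)
  have "norm (t *\<^sub>R d) \<le> norm (x + t *\<^sub>R d) + norm x"
    using norm_triangle_ineq4[of "x + t *\<^sub>R d" x] by simp
  then show False using B[OF ray[OF t(1)]] t(2) by simp
qed

section \<open>Recession directions of the two feasible sets\<close>

lemma primal_recession_trivial:
  assumes "convex C" "cone C" "convex K" "cone K" "linear A"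
    and "primal_feasible A b C K \<noteq> {}" "bounded (primal_feasible A b C K)"
    and "x \<in> C" "- A x \<in> K"
  shows "x = 0"
proof -
  obtain x0 where x0: "x0 \<in> C" "b - A x0 \<in> K" using assms(6) by (auto simp: primal_feasible_def)
  have "x0 + t *\<^sub>R x \<in> primal_feasible A b C K" if "t \<ge> 0" for t
  proof -
    have "t *\<^sub>R x \<in> C" "t *\<^sub>R (- A x) \<in> K"
      using assms(2,4,8,9) that unfolding cone_def by blast+
    then have "x0 + t *\<^sub>R x \<in> C" "(b - A x0) + t *\<^sub>R (- A x) \<in> K"
      using cone_add_closed x0 assms by blast+
    then show ?thesis
      by (simp add: primal_feasible_def linear_add[OF assms(5)] linear_cmul[OF assms(5)]
          algebra_simps)
  qed
  then show ?thesis using bounded_no_recession_direction assms(7) by blast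
qed

lemma dual_feasible_add_recession:
  assumes "y0 \<in> dual_feasible A c C K" "linear A"
    and "y \<in> dual_cone K" "adjoint A y \<in> dual_cone C" "t \<ge> 0"
  shows "y0 + t *\<^sub>R y \<in> dual_feasible A c C K"
proof -
  have lin: "linear (adjoint A)" by (rule adjoint_linear[OF assms(2)])
  have "0 \<le> x \<bullet> (y0 + t *\<^sub>R y)" if "x \<in> K" for x
    using assms that by (simp add: dual_feasible_def dual_cone_def inner_add_right)
  moreover have "0 \<le> x \<bullet> (adjoint A (y0 + t *\<^sub>R y) - c)" if "x \<in> C" for x
  proof -
    have "adjoint A (y0 + t *\<^sub>R y) - c = (adjoint A y0 - c) + t *\<^sub>R adjoint A y"
      by (simp add: linear_add[OF lin] linear_cmul[OF lin])
    moreover have "0 \<le> x \<bullet> (adjoint A y0 - c)" "0 \<le> x \<bullet> adjoint A y"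
      using assms that by (simp_all add: dual_feasible_def dual_cone_def)
    ultimately show ?thesis using assms(5) by (simp only: inner_add_right inner_scaleR_right) simp
  qed
  ultimately show ?thesis by (simp add: dual_feasible_def dual_cone_def)
qed

section \<open>Weak duality and dual points from separation\<close>

lemma weak_duality:
  assumes "linear A" "x \<in> primal_feasible A b C K" "y \<in> dual_feasible A c C K"
  shows "c \<bullet> x \<le> b \<bullet> y"
proof -
  have "0 \<le> (b - A x) \<bullet> y" "0 \<le> x \<bullet> (adjoint A y - c)"
    using assms(2,3) by (auto simp: primal_feasible_def dual_feasible_def dual_cone_def)
  then show ?thesis
    by (simp add: inner_diff_left inner_diff_right adjoint_works[OF assms(1)] inner_commute)
qed

text \<open>
  The right-hand side \<open>b\<close> paired with the unattained level \<open>z\<close> is separated from the closed cone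
  of attainable pairs by some \<open>(y, t)\<close> with \<open>t \<le> 0\<close>. For \<open>t < 0\<close>, rescaling to \<open>t = -1\<close> yields
  the dual point; \<open>t = 0\<close> would make \<open>y\<close> a Farkas certificate of primal infeasibility.
\<close>
lemma dual_feasible_point_below:
  fixes C :: "'a::euclidean_space set" and K :: "'b::euclidean_space set"
  assumes C: "closed C" "convex C" "cone C" and K: "closed K" "convex K" "cone K"
    and A: "linear A"
    and ne: "primal_feasible A b C K \<noteq> {}" and bd: "bounded (primal_feasible A b C K)"
    and z: "\<And>x. x \<in> primal_feasible A b C K \<Longrightarrow> c \<bullet> x < z"
  obtains y where "y \<in> dual_feasible A c C K" "b \<bullet> y < z"
proof -
  obtain x0 where x0: "x0 \<in> C" "b - A x0 \<in> K" using ne by (auto simp: primal_feasible_def)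
  then have zero: "0 \<in> C" "0 \<in> K" using zero_in_nonempty_cone C K by blast+
  define P where "P = C \<times> K \<times> {0::real..}"
  define T where "T = (\<lambda>(x, k, s). (A x + k, c \<bullet> x - s))"
  have T: "T (x, k, s) = (A x + k, c \<bullet> x - s)" for x k s by (simp add: T_def)
  have linT: "linear T"
    by (rule linearI)
      (auto simp: T_def linear_add[OF A] linear_cmul[OF A] inner_add_right algebra_simps)
  have P: "closed P" "convex P" "cone P"
    using C K unfolding P_def
    by (auto intro!: closed_Times convex_Times simp: cone_def)
  have ker: "u = 0" if "u \<in> P" "T u = 0" for u
  proof -
    obtain x k s where u: "u = (x, k, s)" by (cases u) auto
    with that have *: "x \<in> C" "k \<in> K" "A x + k = 0" "c \<bullet> x = s"
      by (simp_all add: P_def T zero_prod_def)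
    then have "k = - A x" by (metis minus_unique)
    then have "x = 0" using primal_recession_trivial[OF C(2,3) K(2,3) A ne bd] * by blast
    then show ?thesis using * u linear_0[OF A] by (simp add: zero_prod_def)
  qed
  have notin: "(b, z) \<notin> T ` P"
  proof
    assume "(b, z) \<in> T ` P"
    then obtain x k s where *: "x \<in> C" "k \<in> K" "s \<ge> 0" "b = A x + k" "z = c \<bullet> x - s"
      by (auto simp: P_def T)
    then have "x \<in> primal_feasible A b C K" by (simp add: primal_feasible_def)
    from z[OF this] * show False by simp
  qed
  have "T ` P \<noteq> {}" using zero by (auto simp: P_def)
  with notin obtain w where w: "w \<in> dual_cone (T ` P)" "(b, z) \<bullet> w < 0"
    using cone_separation[of "T ` P" "(b, z)"] closed_linear_image_cone[OF linT P(1,3) ker]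
      convex_linear_image[OF linT P(2)] cone_linear_image[OF P(3) linT] by blast
  obtain y t where "w = (y, t)" by (cases w)
  with w have sep: "b \<bullet> y + z * t < 0"
    and pos: "\<And>x k s. x \<in> C \<Longrightarrow> k \<in> K \<Longrightarrow> s \<ge> 0 \<Longrightarrow> 0 \<le> (A x + k) \<bullet> y + (c \<bullet> x - s) * t"
    by (force simp: dual_cone_def P_def T)+
  have yK: "0 \<le> k \<bullet> y" if "k \<in> K" for k
    using pos[OF zero(1) that, of 0] linear_0[OF A] by simp
  have yC: "0 \<le> A x \<bullet> y + (c \<bullet> x) * t" if "x \<in> C" for x
    using pos[OF that zero(2), of 0] by simp
  have "t \<le> 0" using pos[OF zero, of 1] linear_0[OF A] by simp
  moreover have "t \<noteq> 0"
  proof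
    assume "t = 0"
    then have "0 \<le> A x0 \<bullet> y" "b \<bullet> y < 0" using yC[OF x0(1)] sep by simp_all
    then show False using yK[OF x0(2)] by (simp add: inner_diff_left)
  qed
  ultimately have t: "t < 0" by simp
  define y' where "y' = (1 / - t) *\<^sub>R y"
  have "y' \<in> dual_cone K"
    using yK t by (simp add: y'_def dual_cone_def divide_nonneg_neg zero_le_divide_iff)
  moreover have "adjoint A y' - c \<in> dual_cone C"
  proof -
    have "0 \<le> x \<bullet> (adjoint A y' - c)" if "x \<in> C" for x
      using yC[OF that] t
      by (simp add: y'_def inner_diff_right adjoint_works[OF A] field_simps inner_commute)
    then show ?thesis by (simp add: dual_cone_def)
  qed
  moreover have "b \<bullet> y' < z"
    using sep t by (simp add: y'_def field_simps)
  ultimately show ?thesis using that by (simp add: dual_feasible_def)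
qed

section \<open>Strong duality\<close>

lemma primal_maximum_attained:
  fixes C :: "'a::euclidean_space set" and K :: "'b::euclidean_space set"
  assumes "closed C" "closed K" "linear A"
    and "primal_feasible A b C K \<noteq> {}" "bounded (primal_feasible A b C K)"
  obtains x where "x \<in> primal_feasible A b C K"
    "\<And>u. u \<in> primal_feasible A b C K \<Longrightarrow> c \<bullet> u \<le> c \<bullet> x"
proof -
  have "continuous_on UNIV (\<lambda>x. b - A x)"
    using assms(3) by (intro continuous_intros linear_continuous_on)
      (simp add: linear_conv_bounded_linear)
  then have "closed ((\<lambda>x. b - A x) -` K)" using assms(2) by (simp add: closed_vimage)
  moreover have "primal_feasible A b C K = C \<inter> (\<lambda>x. b - A x) -` K"
    by (auto simp: primal_feasible_def)
  ultimately have "compact (primal_feasible A b C K)"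
    using assms(1,5) by (simp add: compact_eq_bounded_closed closed_Int)
  moreover have "continuous_on (primal_feasible A b C K) (\<lambda>x. c \<bullet> x)"
    by (intro continuous_intros)
  ultimately show ?thesis using continuous_attains_sup assms(4) that by metis
qed

lemma strong_duality_bounded_primal:
  fixes C :: "'a::euclidean_space set" and K :: "'b::euclidean_space set"
  assumes C: "closed C" "convex C" "cone C" and K: "closed K" "convex K" "cone K"
    and A: "linear A"
    and ne: "primal_feasible A b C K \<noteq> {}" and bd: "bounded (primal_feasible A b C K)"
  shows "dual_feasible A c C K \<noteq> {}" "strong_duality A b c C K"
proof -
  obtain x where x: "x \<in> primal_feasible A b C K"
    and max: "\<And>u. u \<in> primal_feasible A b C K \<Longrightarrow> c \<bullet> u \<le> c \<bullet> x"
    using primal_maximum_attained[OF C(1) K(1) A ne bd] by blast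
  have near: "\<exists>y \<in> dual_feasible A c C K. b \<bullet> y < z" if "c \<bullet> x < z" for z
    by (rule dual_feasible_point_below[OF C K A ne bd, of c z])
      (use max that order_le_less_trans in blast)+
  show "dual_feasible A c C K \<noteq> {}" using near[of "c \<bullet> x + 1"] by auto
  have pv: "primal_value A b c C K = ereal (c \<bullet> x)"
    unfolding primal_value_def
    by (rule antisym) (auto intro!: SUP_least SUP_upper2[OF x] max)
  have "dual_value A b c C K = ereal (c \<bullet> x)"
    unfolding dual_value_def
  proof (rule antisym)
    show "(INF y\<in>dual_feasible A c C K. ereal (b \<bullet> y)) \<le> ereal (c \<bullet> x)"
    proof (rule ereal_le_epsilon2)
      fix e :: real assume "0 < e"
      then obtain y where "y \<in> dual_feasible A c C K" "b \<bullet> y < c \<bullet> x + e"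
        using near[of "c \<bullet> x + e"] by auto
      then show "(INF y\<in>dual_feasible A c C K. ereal (b \<bullet> y)) \<le> ereal (c \<bullet> x) + ereal e"
        by (intro INF_lower2) auto
    qed
  qed (auto intro!: INF_greatest weak_duality[OF A x])
  with pv x show "strong_duality A b c C K"
    by (auto simp: strong_duality_def primal_optimal_def)
qed

section \<open>Unboundedness of the dual feasible set\<close>

text \<open>
  A nonzero functional that is nonnegative on the proper closed convex cone \<open>A C + K\<close> is a
  recession direction of the dual feasible set. Properness is all that matters: if
  \<open>A C + K\<close> is everything, then negatives of elements of \<open>K\<close> and of \<open>A C\<close> are representable, and
  the trivial primal recession cone forces the representation to be the obvious one.
\<close>
lemma bounded_dual_imp_subspaces:
  fixes C :: "'a::euclidean_space set" and K :: "'b::euclidean_space set"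
  assumes C: "closed C" "convex C" "cone C" and K: "closed K" "convex K" "cone K"
    and A: "linear A"
    and ne: "primal_feasible A b C K \<noteq> {}" and bd: "bounded (primal_feasible A b C K)"
    and bdY: "bounded (dual_feasible A c C K)"
  shows "subspace C" "subspace K"
proof -
  have CK: "C \<noteq> {}" "K \<noteq> {}" using ne by (auto simp: primal_feasible_def)
  then have zero: "0 \<in> C" "0 \<in> K" using zero_in_nonempty_cone C K by blast+
  note rec = primal_recession_trivial[OF C(2,3) K(2,3) A ne bd]
  define T where "T = (\<lambda>(x, k). A x + k)"
  have T: "T (x, k) = A x + k" for x k by (simp add: T_def)
  have linT: "linear T"
    by (rule linearI) (auto simp: T_def linear_add[OF A] linear_cmul[OF A] algebra_simps)
  have P: "closed (C \<times> K)" "convex (C \<times> K)" "cone (C \<times> K)"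
    using C K by (auto intro!: closed_Times convex_Times simp: cone_def)
  have ker: "u = 0" if uP: "u \<in> C \<times> K" and "T u = 0" for u
  proof -
    obtain x k where u: "u = (x, k)" "x \<in> C" "k \<in> K" using uP by auto
    with that(2) have "A x + k = 0" by (simp add: T)
    moreover from this have "k = - A x" by (metis minus_unique)
    ultimately have "x = 0" using rec u by blast
    then show ?thesis using \<open>A x + k = 0\<close> u linear_0[OF A] by (simp add: zero_prod_def)
  qed
  have surj: "v \<in> T ` (C \<times> K)" for v
  proof (rule ccontr)
    assume "v \<notin> T ` (C \<times> K)"
    moreover have "T ` (C \<times> K) \<noteq> {}" using CK by simp
    ultimately obtain y where y: "y \<in> dual_cone (T ` (C \<times> K))" "v \<bullet> y < 0"
      using cone_separation[of "T ` (C \<times> K)" v] closed_linear_image_cone[OF linT P(1,3) ker]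
        convex_linear_image[OF linT P(2)] cone_linear_image[OF P(3) linT] by blast
    then have pos: "0 \<le> (A x + k) \<bullet> y" if "x \<in> C" "k \<in> K" for x k
      using that by (force simp: dual_cone_def T)
    have "y \<in> dual_cone K"
      using pos[OF zero(1)] linear_0[OF A] by (simp add: dual_cone_def)
    moreover have "adjoint A y \<in> dual_cone C"
      using pos[OF _ zero(2)] by (simp add: dual_cone_def adjoint_works[OF A])
    moreover obtain y0 where "y0 \<in> dual_feasible A c C K"
      using strong_duality_bounded_primal(1)[OF C K A ne bd] by blast
    ultimately have "y = 0"
      using bounded_no_recession_direction[OF bdY] dual_feasible_add_recession A by metis
    with y(2) show False by simp
  qed
  have "- k \<in> K" if k: "k \<in> K" for k
  proof -
    obtain x k' where *: "x \<in> C" "k' \<in> K" "- k = A x + k'" using surj[of "- k"] by (auto simp: T)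
    then have "- A x = k + k'"
      by (metis add.commute add.inverse_inverse add_diff_cancel minus_diff_eq uminus_add_conv_diff)
    then have "x = 0" using rec[OF *(1)] cone_add_closed[OF K(2,3) k *(2)] by simp
    then show ?thesis using * linear_0[OF A] by simp
  qed
  then show "subspace K" using convex_cone_subspaceI CK K by blast
  have "- x \<in> C" if x: "x \<in> C" for x
  proof -
    obtain x' k where *: "x' \<in> C" "k \<in> K" "- A x = A x' + k"
      using surj[of "- A x"] by (auto simp: T)
    then have "- A (x + x') = k" by (simp add: linear_add[OF A] algebra_simps)
    then have "x + x' = 0" using rec cone_add_closed[OF C(2,3) x *(1)] *(2) by blast
    then have "x' = - x" by (metis minus_unique)
    then show ?thesis using * by simp
  qed
  then show "subspace C" using convex_cone_subspaceI CK C by blast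
qed

theorem corollary3:
  fixes C :: "'a::euclidean_space set"
    and K :: "'b::euclidean_space set"
    and A :: "'a \<Rightarrow> 'b"
    and b :: 'b
    and c :: 'a
  assumes "C \<noteq> {}" and "closed C" and "convex C" and "cone C"
    and "K \<noteq> {}" and "closed K" and "convex K" and "cone K"
    and "C \<noteq> {0}"
    and "C \<noteq> UNIV \<or> K \<noteq> UNIV"
    and "linear A"
    and "primal_feasible A b C K \<noteq> {}"
    and "bounded (primal_feasible A b C K)"
  shows "(dual_feasible A c C K \<noteq> {} \<longrightarrow> strong_duality A b c C K) \<and>
         (c \<in> orthogonal_comp (lineal C) \<or> pointed_cone C \<longrightarrow>
            dual_feasible A c C K \<noteq> {} \<and> strong_duality A b c C K) \<and>
         ((\<not> subspace K \<and> K \<noteq> {0}) \<or> (\<not> subspace C \<and> C \<noteq> {0}) \<longrightarrow>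
            \<not> bounded (dual_feasible A c C K))"
  using strong_duality_bounded_primal[OF assms(2-4,6-8,11-13)]
    bounded_dual_imp_subspaces[OF assms(2-4,6-8,11-13)]
  by blast

end
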